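(* Let $\{u_n(t)\}_{n\ge 0}$ be a sequence of polynomials with complex coefficients such that $u_n$ has degree $n$ for every $n\ge 0$, and let $\hat P$ and $\hat M$ be the linear operators on the space $\mathcal P$ of complex polynomials in $t$ that satisfy $$\hat P u_n(t)=n\,u_{n-1}(t),\qquad \hat M u_n(t)=u_{n+1}(t),\qquad n\ge 0.$$ Then $\hat P$ and $\hat M$ are differential operators of finite or infinite order with polynomial coefficients; that is, there exist sequences of polynomials $\{q_k(t)\}_{k\ge 0}$ and $\{m_k(t)\}_{k\ge 0}$ such that, for every polynomial $w(t)\in\mathcal P$, $$\hat P w(t)=\sum_{k\ge 0} q_k(t)\,\frac{w^{(k)}(t)}{k!},\qquad \hat M w(t)=\sum_{k\ge 0} m_k(t)\,\frac{w^{(k)}(t)}{k!}.$$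
   Context: Here $w^{(k)}$ denotes the $k$-th derivative of $w$ with respect to $t$; for each polynomial $w$ the sums are finite since $w^{(k)}=0$ for $k>\deg w$. For $n=0$ the relation $\hat P u_n=n u_{n-1}$ means $\hat P u_0=0$. *)

theory Defs
  imports
    "HOL-Computational_Algebra.Polynomial"
    "HOL-Library.Groups_Big_Fun"
    Complex_Main
begin

text \<open>
  Series over all derivatives of a polynomial are written with \<^const>\<open>Sum_any\<close>, which is 0 by
  convention if infinitely many summands are nonzero.  The following facts show that this
  never happens here.
\<close>

lemma higher_pderiv_eq_0:
  fixes w :: "complex poly"
  assumes "degree w < k"
  shows "(pderiv ^^ k) w = 0"
  using assms
proof (induction k arbitrary: w)
  case 0
  then show ?case by simp
next
  case (Suc k)
  show ?case
  proof (cases "degree w = 0")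
    case True
    then have "pderiv w = 0" by (simp add: pderiv_eq_0_iff)
    moreover have "(pderiv ^^ k) (0 :: complex poly) = 0" by (induction k) auto
    ultimately show ?thesis by (simp add: funpow_Suc_right del: funpow.simps)
  next
    case False
    then have "degree (pderiv w) < k" using Suc.prems by (simp add: degree_pderiv)
    then show ?thesis using Suc.IH by (simp add: funpow_Suc_right del: funpow.simps)
  qed
qed

lemma finite_support_higher_pderiv:
  fixes q :: "nat \<Rightarrow> complex poly" and w :: "complex poly"
  shows "finite {k. q k * smult (1 / fact k) ((pderiv ^^ k) w) \<noteq> 0}"
  by (rule finite_subset[of _ "{..degree w}"]) (use higher_pderiv_eq_0 not_le in auto)

end

theory Submission
  imports Defs
begin

fun diff_coeffs :: "(complex poly \<Rightarrow> complex poly) \<Rightarrow> nat \<Rightarrow> complex poly" where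
  "diff_coeffs L n = L (monom 1 n) -
     (\<Sum>k<n. diff_coeffs L k * smult (1 / fact k) ((pderiv ^^ k) (monom 1 n)))"

declare diff_coeffs.simps [simp del]

text \<open>The equation at \<open>monom 1 n\<close> determines the \<open>n\<close>-th coefficient from the earlier ones, since
  \<open>(pderiv ^^ n) (monom 1 n)\<close> is the constant \<open>fact n\<close>; hence every linear operator is a
  differential operator.\<close>

lemma linear_eq_differential_operator:
  fixes L :: "complex poly \<Rightarrow> complex poly"
  assumes "Vector_Spaces.linear smult smult L"
  shows "L w = Sum_any (\<lambda>k. diff_coeffs L k * smult (1 / fact k) ((pderiv ^^ k) w))"
proof -
  interpret L: Vector_Spaces.linear smult smult L by fact
  \<comment> \<open>A truncation at a fixed \<open>N\<close> is a finite sum, so it is linear on all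
    polynomials and avoids reasoning about supports in \<open>Sum_any\<close>.\<close>
  define D where "D N v = (\<Sum>k\<le>N. diff_coeffs L k * smult (1 / fact k) ((pderiv ^^ k) v))" for N v
  \<comment> \<open>Derivatives of order above \<open>degree v\<close> vanish, so any bound
    \<open>N\<close> on the degree gives the same value.\<close>
  have Sum_any_eq_D: "Sum_any (\<lambda>k. diff_coeffs L k * smult (1 / fact k) ((pderiv ^^ k) v)) = D N v"
    if "degree v \<le> N" for v N
    unfolding D_def using that
    by (intro Sum_any.expand_superset)
       (auto intro!: leI dest: order.strict_trans1 [OF that] simp: higher_pderiv_eq_0)
  have D_sum: "D N (\<Sum>i\<in>A. smult (c i) (f i)) = (\<Sum>i\<in>A. smult (c i) (D N (f i)))" for N c f and A :: "nat set"
    unfolding D_def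
    by (simp add: higher_pderiv_sum higher_pderiv_smult L.vs1.scale_sum_right sum_distrib_left mult.commute)
       (rule sum.swap)
  have D_monom: "D N (monom 1 n) = L (monom 1 n)" if "n \<le> N" for N n
  proof -
    \<comment> \<open>Only coefficient 0 survives, where \<open>pochhammer 1 n\<close> equals
      \<open>fact n\<close>.\<close>
    have "(pderiv ^^ n) (monom 1 n) = [:fact n :: complex:]"
      by (intro poly_eqI)
         (auto simp: coeff_higher_pderiv pochhammer_fact coeff_pCons split: nat.split)
    \<comment> \<open>The last summand reduces to \<open>diff_coeffs L n\<close>, whose recursion
      subtracts exactly the earlier summands.\<close>
    then have "D n (monom 1 n) = L (monom 1 n)"
      by (simp add: D_def lessThan_Suc_atMost [symmetric] diff_coeffs.simps [of L n])
    \<comment> \<open>Both truncations equal the full series at \<open>monom 1 n\<close>, so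
      \<open>n\<close> may be replaced by the common bound \<open>N\<close>.\<close>
    then show ?thesis
      using Sum_any_eq_D [of "monom 1 n" n] Sum_any_eq_D [of "monom 1 n" N] that
      by (simp add: degree_monom_eq)
  qed
  have w: "w = (\<Sum>i\<le>degree w. smult (coeff w i) (monom 1 i))"
    by (simp add: smult_monom poly_as_sum_of_monoms)
  have "L w = (\<Sum>i\<le>degree w. smult (coeff w i) (L (monom 1 i)))"
    by (subst w) (simp only: L.sum L.scale)
  also have "\<dots> = D (degree w) (\<Sum>i\<le>degree w. smult (coeff w i) (monom 1 i))"
    \<comment> \<open>\<open>smult_monom\<close> would absorb the scalars into the monomials, and
      \<open>D_sum\<close> and \<open>D_monom\<close> would no longer match.\<close>
    by (simp add: D_sum D_monom del: smult_monom)
  also have "\<dots> = D (degree w) w"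
    using w by simp
  finally show ?thesis
    by (simp only: Sum_any_eq_D [OF order_refl])
qed

theorem mainTheorem2:
  fixes u :: "nat \<Rightarrow> complex poly"
    and P M :: "complex poly \<Rightarrow> complex poly"
  assumes u_nonzero: "\<And>n. u n \<noteq> 0"
    and u_degree: "\<And>n. degree (u n) = n"
    and P_linear: "Vector_Spaces.linear smult smult P"
    and M_linear: "Vector_Spaces.linear smult smult M"
    and P_lower: "\<And>n. P (u n) = smult (of_nat n) (u (n - 1))"
    and M_raise: "\<And>n. M (u n) = u (n + 1)"
  shows "\<exists>q m :: nat \<Rightarrow> complex poly. \<forall>w :: complex poly.
           P w = Sum_any (\<lambda>k. q k * smult (1 / fact k) ((pderiv ^^ k) w)) \<and>
           M w = Sum_any (\<lambda>k. m k * smult (1 / fact k) ((pderiv ^^ k) w))"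
  \<comment> \<open>The witnesses are \<open>diff_coeffs P\<close> and
    \<open>diff_coeffs M\<close>.\<close>
  using linear_eq_differential_operator [OF P_linear] linear_eq_differential_operator [OF M_linear]
  by blast

end
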